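(* Let $K\subset\mathbb{R}^3$ be a knot with knot group $\pi_K$, and let $\{g_1,\ldots,g_r\}$ be a meridional generating set for $\pi_K$. If $\rho:\pi_K\to \mathrm{GL}_n(\mathbb{C})$ is an irreducible KCH representation of $\pi_K$, then $n\le r$.
   Context: $\pi_K$ is the fundamental group of the complement $\overline{\mathbb{R}^3\setminus n(K)}$ of an open tubular neighbourhood of $K$. A generating set $\{g_1,\dots,g_r\}$ of $\pi_K$ is called meridional if every $g_i$ is a meridian of $K$. All meridians of the oriented knot $K$ are conjugate in $\pi_K$. Let $V$ be a complex vector space of dimension $n$. A homomorphism $\rho:\pi_K\to \mathrm{GL}(V)$ is a KCH representation of degree $n$ if, for a meridian $m$ of $K$, the map $\rho(m)$ is diagonalizable and has $1$ as an eigenvalue with multiplicity (exactly) $n-1$; thus the remaining eigenvalue $\mu_0$ satisfies $\mu_0\neq 1$. *)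

theory Defs
  imports "HOL-Analysis.Analysis" "HOL-Algebra.Generated_Groups"
begin

section \<open>The fundamental group\<close>

definition loops_at :: "'a::topological_space set \<Rightarrow> 'a \<Rightarrow> (real \<Rightarrow> 'a) set" where
  "loops_at X x = {p. path p \<and> path_image p \<subseteq> X \<and> pathstart p = x \<and> pathfinish p = x}"

definition path_class :: "'a::topological_space set \<Rightarrow> (real \<Rightarrow> 'a) \<Rightarrow> (real \<Rightarrow> 'a) set" where
  "path_class X p = {q. homotopic_paths X p q}"

definition fundamental_group ::
  "'a::real_normed_vector set \<Rightarrow> 'a \<Rightarrow> (real \<Rightarrow> 'a) set monoid" where
  "fundamental_group X x =
     \<lparr> carrier = path_class X ` loops_at X x,
       mult = (\<lambda>A B. \<Union>p\<in>A. \<Union>q\<in>B. path_class X (p +++ q)),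
       one = path_class X (linepath x x) \<rparr>"

lemma path_class_eqI: "homotopic_paths X p q \<Longrightarrow> path_class X p = path_class X q"
  unfolding path_class_def
  by (blast intro: homotopic_paths_trans homotopic_paths_sym)

lemma path_class_mult:
  assumes "p \<in> loops_at X x" "q \<in> loops_at X x"
  shows "path_class X p \<otimes>\<^bsub>fundamental_group X x\<^esub> path_class X q = path_class X (p +++ q)"
proof -
  have "path_class X (p' +++ q') = path_class X (p +++ q)"
    if "homotopic_paths X p p'" "homotopic_paths X q q'" for p' q'
    using assms that
    by (intro path_class_eqI homotopic_paths_sym[OF homotopic_paths_join])
       (auto simp: loops_at_def)
  moreover have "p \<in> path_class X p" "q \<in> path_class X q"
    using assms by (auto simp: path_class_def loops_at_def)
  moreover have "homotopic_paths X p p'" if "p' \<in> path_class X p" for p p'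
    using that by (simp add: path_class_def)
  ultimately have "(\<Union>p'\<in>path_class X p. \<Union>q'\<in>path_class X q. path_class X (p' +++ q')) =
      path_class X (p +++ q)"
    by blast
  then show ?thesis
    by (simp add: fundamental_group_def)
qed

lemma loops_at_join:
  "p \<in> loops_at X x \<Longrightarrow> q \<in> loops_at X x \<Longrightarrow> p +++ q \<in> loops_at X x"
  by (auto simp: loops_at_def path_image_join)

lemma group_fundamental_group:
  assumes "x \<in> X"
  shows "group (fundamental_group X x)"
proof (rule groupI)
  let ?G = "fundamental_group X x"
  have car: "carrier ?G = path_class X ` loops_at X x"
    and one: "\<one>\<^bsub>?G\<^esub> = path_class X (linepath x x)"
    by (simp_all add: fundamental_group_def)
  have const: "linepath x x \<in> loops_at X x"
    using assms by (auto simp: loops_at_def)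
  show "\<one>\<^bsub>?G\<^esub> \<in> carrier ?G"
    using const by (auto simp: car one)
  show "a \<otimes>\<^bsub>?G\<^esub> b \<in> carrier ?G" if "a \<in> carrier ?G" "b \<in> carrier ?G" for a b
    using that by (auto simp: car path_class_mult loops_at_join)
  show "a \<otimes>\<^bsub>?G\<^esub> b \<otimes>\<^bsub>?G\<^esub> c = a \<otimes>\<^bsub>?G\<^esub> (b \<otimes>\<^bsub>?G\<^esub> c)"
    if abc: "a \<in> carrier ?G" "b \<in> carrier ?G" "c \<in> carrier ?G" for a b c
  proof -
    obtain p q r where eq: "a = path_class X p" "b = path_class X q" "c = path_class X r"
      and pqr: "p \<in> loops_at X x" "q \<in> loops_at X x" "r \<in> loops_at X x"
      using abc by (auto simp: car)
    have "path_class X ((p +++ q) +++ r) = path_class X (p +++ (q +++ r))"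
      using pqr by (intro path_class_eqI homotopic_paths_sym[OF homotopic_paths_assoc])
        (auto simp: loops_at_def)
    then show ?thesis
      using pqr by (simp add: eq path_class_mult loops_at_join)
  qed
  show "\<one>\<^bsub>?G\<^esub> \<otimes>\<^bsub>?G\<^esub> a = a" if a: "a \<in> carrier ?G" for a
  proof -
    obtain p where eq: "a = path_class X p" and p: "p \<in> loops_at X x"
      using a by (auto simp: car)
    have "path_class X (linepath x x +++ p) = path_class X p"
      using p by (intro path_class_eqI homotopic_paths_lid') (auto simp: loops_at_def)
    then show ?thesis
      using p const by (simp add: eq one path_class_mult)
  qed
  show "\<exists>b\<in>carrier ?G. b \<otimes>\<^bsub>?G\<^esub> a = \<one>\<^bsub>?G\<^esub>" if a: "a \<in> carrier ?G" for a
  proof -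
    obtain p where eq: "a = path_class X p" and p: "p \<in> loops_at X x"
      using a by (auto simp: car)
    have r: "reversepath p \<in> loops_at X x"
      using p by (auto simp: loops_at_def)
    have "path_class X (reversepath p +++ p) = path_class X (linepath x x)"
      using p homotopic_paths_linv[of p X] by (intro path_class_eqI) (auto simp: loops_at_def)
    then show ?thesis
      using p r by (intro bexI[of _ "path_class X (reversepath p)"])
        (auto simp: eq one path_class_mult car)
  qed
qed

section \<open>Oriented knots, tubular neighbourhoods and meridians\<close>

text \<open>
  \<open>S\<close> is meant to be open. In finite dimension the Frechet derivative is of class \<open>C\<^sup>k\<close> iff
  all directional derivatives are, so the recursion avoids a norm on the space of linear maps.
\<close>

primrec Ck_on :: "nat \<Rightarrow> 'a::euclidean_space set \<Rightarrow> ('a \<Rightarrow> 'b::euclidean_space) \<Rightarrow> bool" where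
  "Ck_on 0 S f \<longleftrightarrow> continuous_on S f"
| "Ck_on (Suc k) S f \<longleftrightarrow>
     (\<exists>f'. (\<forall>x\<in>S. (f has_derivative f' x) (at x)) \<and> (\<forall>v. Ck_on k S (\<lambda>x. f' x v)))"

definition smooth_on :: "'a::euclidean_space set \<Rightarrow> ('a \<Rightarrow> 'b::euclidean_space) \<Rightarrow> bool" where
  "smooth_on S f \<longleftrightarrow> (\<forall>k. Ck_on k S f)"

text \<open>
  An oriented knot is given by a smooth embedding \<open>k\<close> of the circle \<open>\<real>/\<int>\<close>, written as a
  1-periodic function on \<open>\<real>\<close>. The knot as a subset of \<open>\<real>\<^sup>3\<close> is \<open>range k\<close>.
\<close>

definition oriented_knot :: "(real \<Rightarrow> real^3) \<Rightarrow> bool" where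
  "oriented_knot k \<longleftrightarrow>
     smooth_on UNIV k \<and>
     (\<forall>t. vector_derivative k (at t) \<noteq> 0) \<and>
     (\<forall>s t. k s = k t \<longleftrightarrow> s - t \<in> \<int>)"

text \<open>
  A closed tubular neighbourhood of \<open>k\<close> is a smooth embedding \<open>\<phi>\<close> of the solid torus
  \<open>\<real>/\<int> \<times> D\<^sup>2\<close> (with \<open>D\<^sup>2\<close> the closed unit disc in the complex plane) whose core is \<open>k\<close>.
  Smoothness up to the boundary means that \<open>\<phi>\<close> is smooth on an open set containing
  \<open>\<real> \<times> D\<^sup>2\<close>. The determinant condition says that \<open>\<phi>\<close> is an orientation-preserving immersion,
  so that the discs \<open>\<phi> ({t} \<times> D\<^sup>2)\<close> are oriented by the right-hand rule.
\<close>

definition tubular_neighbourhood ::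
  "(real \<Rightarrow> real^3) \<Rightarrow> (real \<times> complex \<Rightarrow> real^3) \<Rightarrow> bool" where
  "tubular_neighbourhood k \<phi> \<longleftrightarrow>
     (\<exists>U. open U \<and> UNIV \<times> cball 0 1 \<subseteq> U \<and> smooth_on U \<phi>) \<and>
     (\<forall>s t. \<forall>z\<in>cball 0 1. \<forall>w\<in>cball 0 1.
        \<phi> (s, z) = \<phi> (t, w) \<longleftrightarrow> s - t \<in> \<int> \<and> z = w) \<and>
     (\<forall>t. \<forall>z\<in>cball 0 1.
        let D = frechet_derivative \<phi> (at (t, z))
        in det (vector [D (1, 0), D (0, 1), D (0, \<i>)] :: real^3^3) > 0) \<and>
     (\<forall>t. \<phi> (t, 0) = k t)"

definition open_tube :: "(real \<times> complex \<Rightarrow> real^3) \<Rightarrow> (real^3) set" where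
  "open_tube \<phi> = \<phi> ` (UNIV \<times> ball 0 1)"

definition knot_exterior :: "(real \<times> complex \<Rightarrow> real^3) \<Rightarrow> (real^3) set" where
  "knot_exterior \<phi> = closure (UNIV - open_tube \<phi>)"

definition knot_group ::
  "(real \<times> complex \<Rightarrow> real^3) \<Rightarrow> real^3 \<Rightarrow> (real \<Rightarrow> real^3) set monoid" where
  "knot_group \<phi> x0 = fundamental_group (knot_exterior \<phi>) x0"

text \<open>
  The positively oriented boundary of the fibre disc over \<open>t\<close>, started at the boundary
  point \<open>\<phi> (t, w)\<close>, where \<open>norm w = 1\<close>.
\<close>

definition meridian_curve ::
  "(real \<times> complex \<Rightarrow> real^3) \<Rightarrow> real \<Rightarrow> complex \<Rightarrow> real \<Rightarrow> real^3" where
  "meridian_curve \<phi> t w = (\<lambda>s. \<phi> (t, w * cis (2 * pi * s)))"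

definition meridians ::
  "(real \<times> complex \<Rightarrow> real^3) \<Rightarrow> real^3 \<Rightarrow> (real \<Rightarrow> real^3) set set" where
  "meridians \<phi> x0 =
     {path_class (knot_exterior \<phi>) (\<gamma> +++ meridian_curve \<phi> t w +++ reversepath \<gamma>) |\<gamma> t w.
        norm w = 1 \<and> path \<gamma> \<and> path_image \<gamma> \<subseteq> knot_exterior \<phi> \<and>
        pathstart \<gamma> = x0 \<and> pathfinish \<gamma> = \<phi> (t, w)}"

definition meridional_generating_family ::
  "(real \<times> complex \<Rightarrow> real^3) \<Rightarrow> real^3 \<Rightarrow> nat \<Rightarrow> (nat \<Rightarrow> (real \<Rightarrow> real^3) set) \<Rightarrow> bool" where
  "meridional_generating_family \<phi> x0 r g \<longleftrightarrow>
     (\<forall>i\<in>{1..r}. g i \<in> meridians \<phi> x0) \<and>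
     generate (knot_group \<phi> x0) (g ` {1..r}) = carrier (knot_group \<phi> x0)"

section \<open>KCH representations\<close>

definition GL :: "('k::field^'n^'n) monoid" where
  "GL = \<lparr> carrier = {A. invertible A}, mult = (**), one = mat 1 \<rparr>"

definition diagonalizable :: "'k::field^'n^'n \<Rightarrow> bool" where
  "diagonalizable A \<longleftrightarrow>
     (\<exists>P D :: 'k^'n^'n. invertible P \<and> (\<forall>i j. i \<noteq> j \<longrightarrow> D $ i $ j = 0) \<and> A = P ** D ** matrix_inv P)"

definition eigenspace :: "'k::field^'n^'n \<Rightarrow> 'k \<Rightarrow> ('k^'n) set" where
  "eigenspace A c = {v. A *v v = c *s v}"

text \<open>
  For a diagonalizable matrix, geometric and algebraic multiplicities of eigenvalues agree.
\<close>

definition eigenvalue_multiplicity :: "'k::field^'n^'n \<Rightarrow> 'k \<Rightarrow> nat" where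
  "eigenvalue_multiplicity A c = vec.dim (eigenspace A c)"

definition representation :: "('g, 'b) monoid_scheme \<Rightarrow> ('g \<Rightarrow> 'k::field^'n^'n) \<Rightarrow> bool" where
  "representation G \<rho> \<longleftrightarrow> \<rho> \<in> hom G GL"

definition irreducible_representation ::
  "('g, 'b) monoid_scheme \<Rightarrow> ('g \<Rightarrow> 'k::field^'n^'n) \<Rightarrow> bool" where
  "irreducible_representation G \<rho> \<longleftrightarrow>
     representation G \<rho> \<and>
     (\<forall>W. vec.subspace W \<and> (\<forall>g\<in>carrier G. \<forall>v\<in>W. \<rho> g *v v \<in> W) \<longrightarrow> W = {0} \<or> W = UNIV)"

text \<open>
  Since all meridians of an oriented knot are conjugate, it does not matter which one is tested.
\<close>

definition KCH_representation ::
  "(real \<times> complex \<Rightarrow> real^3) \<Rightarrow> real^3 \<Rightarrow> ((real \<Rightarrow> real^3) set \<Rightarrow> complex^'n^'n) \<Rightarrow> bool" where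
  "KCH_representation \<phi> x0 \<rho> \<longleftrightarrow>
     representation (knot_group \<phi> x0) \<rho> \<and>
     (\<exists>m\<in>meridians \<phi> x0.
        diagonalizable (\<rho> m) \<and> eigenvalue_multiplicity (\<rho> m) 1 = CARD('n) - 1)"

end

theory Submission
  imports Defs
begin

text \<open>
  All meridians are conjugate: the meridian curves at two points of the boundary torus are
  homotopic along any path in the torus joining the points. Hence for every generator \<open>g\<^sub>i\<close> the map
  \<open>\<rho> (g\<^sub>i) - 1\<close> has, like \<open>\<rho> (m) - 1\<close>, rank at most one, so its image lies in the span of one
  vector \<open>u\<^sub>i\<close>. If \<open>W\<close> is the span of \<open>u\<^sub>1, \<dots>, u\<^sub>r\<close>, then every element of the knot group acts
  trivially modulo \<open>W\<close>; in particular \<open>W\<close> is invariant. It is nonzero, since \<open>\<rho> (m)\<close> is not the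
  identity, so irreducibility gives that \<open>W\<close> is the whole space, whence \<open>n \<le> r\<close>.
\<close>

section \<open>Conjugacy of meridians\<close>

lemma homotopic_paths_cancel_middle:
  fixes S :: "'a::real_normed_vector set"
  assumes "path p" "path_image p \<subseteq> S" "path q" "path_image q \<subseteq> S" "path r" "path_image r \<subseteq> S"
    and "pathfinish p = pathfinish q" "pathstart r = pathfinish q"
  shows "homotopic_paths S ((p +++ reversepath q) +++ (q +++ r)) (p +++ r)"
proof -
  note sub = subset_path_image_join
  let ?c = "linepath (pathfinish q) (pathfinish q)"
  have "homotopic_paths S ((p +++ reversepath q) +++ (q +++ r)) (p +++ (reversepath q +++ (q +++ r)))"
    using assms by (intro homotopic_paths_sym[OF homotopic_paths_assoc]) (auto simp: sub)
  also have "homotopic_paths S \<dots> (p +++ ((reversepath q +++ q) +++ r))"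
    using assms by (intro homotopic_paths_join homotopic_paths_assoc) (auto simp: sub)
  also have "homotopic_paths S \<dots> (p +++ (?c +++ r))"
    using assms by (intro homotopic_paths_join homotopic_paths_linv) (auto simp: sub)
  also have "homotopic_paths S \<dots> (p +++ r)"
    using assms by (intro homotopic_paths_join homotopic_paths_lid') (auto simp: sub)
  finally show ?thesis .
qed

text \<open>The inner tail \<open>q\<close> is run backwards and then forwards, so it cancels after
  reassociation. This evaluates both products in \<open>meridians_conjugate\<close>.\<close>

lemma homotopic_paths_join_tails:
  fixes S :: "'a::real_normed_vector set"
  assumes paths: "path p" "path_image p \<subseteq> S" "path u" "path_image u \<subseteq> S" "path q" "path_image q \<subseteq> S"
      "path v" "path_image v \<subseteq> S" "path r" "path_image r \<subseteq> S"
    and ends: "pathfinish p = pathstart u" "pathfinish u = pathfinish q" "pathfinish q = pathstart v"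
      "pathfinish v = pathfinish r"
  shows "homotopic_paths S ((p +++ u +++ reversepath q) +++ (q +++ v +++ reversepath r))
           (p +++ (u +++ v) +++ reversepath r)"
proof -
  note sub = subset_path_image_join
  have "homotopic_paths S ((p +++ u +++ reversepath q) +++ (q +++ v +++ reversepath r))
      (((p +++ u) +++ reversepath q) +++ (q +++ v +++ reversepath r))"
    using assms by (intro homotopic_paths_join homotopic_paths_assoc) (auto simp: sub)
  also have "homotopic_paths S \<dots> ((p +++ u) +++ (v +++ reversepath r))"
    using assms by (intro homotopic_paths_cancel_middle) (auto simp: sub)
  also have "homotopic_paths S \<dots> (p +++ (u +++ (v +++ reversepath r)))"
    using assms by (intro homotopic_paths_sym[OF homotopic_paths_assoc]) (auto simp: sub)
  also have "homotopic_paths S \<dots> (p +++ (u +++ v) +++ reversepath r)"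
    using assms by (intro homotopic_paths_join homotopic_paths_assoc) (auto simp: sub)
  finally show ?thesis .
qed

section \<open>The boundary torus of the tube and its meridian curves\<close>

text \<open>Injectivity of \<open>\<phi>\<close> on the closed solid torus keeps boundary points out
  of the open tube, and the complement of the tube lies in its closure.\<close>

lemma tube_boundary_in_knot_exterior:
  assumes "tubular_neighbourhood k \<phi>" "norm w = 1"
  shows "\<phi> (t, w) \<in> knot_exterior \<phi>"
proof -
  have inj: "\<phi> (s, z) = \<phi> (t, w) \<longleftrightarrow> s - t \<in> \<int> \<and> z = w"
    if "z \<in> cball 0 1" "w \<in> cball 0 1" for s t z w
    using assms(1) that unfolding tubular_neighbourhood_def by blast
  have "\<phi> (t, w) \<noteq> \<phi> (s, z)" if "z \<in> ball 0 1" for s z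
    using inj[of w z t s] assms(2) that by auto
  then have "\<phi> (t, w) \<notin> open_tube \<phi>"
    unfolding open_tube_def by fastforce
  then show ?thesis
    unfolding knot_exterior_def by (auto intro: subsetD[OF closure_subset])
qed

text \<open>The plane covers the boundary torus by this map. Its continuity is the order-zero case
  of the smoothness of \<open>\<phi>\<close>.\<close>

lemma continuous_on_tube_boundary:
  assumes "tubular_neighbourhood k \<phi>"
  shows "continuous_on UNIV (\<lambda>x. \<phi> (fst x, cis (snd x)))"
proof -
  obtain U where U: "UNIV \<times> cball 0 1 \<subseteq> U" "smooth_on U \<phi>"
    using assms unfolding tubular_neighbourhood_def by blast
  then have "Ck_on 0 U \<phi>"
    unfolding smooth_on_def by blast
  then have "continuous_on U \<phi>"
    by simp
  then have "continuous_on (UNIV \<times> cball 0 1) \<phi>"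
    using U(1) continuous_on_subset by blast
  moreover have "continuous_on UNIV (\<lambda>x::real \<times> real. (fst x, cis (snd x)))"
    by (intro continuous_intros)
  ultimately show ?thesis
    by (rule continuous_on_compose2) auto
qed

lemma fundamental_groupI:
  "p \<in> loops_at X x \<Longrightarrow> path_class X p \<in> carrier (fundamental_group X x)"
  by (simp add: fundamental_group_def)

lemma meridian_curve_path:
  assumes "tubular_neighbourhood k \<phi>" "norm w = 1"
  shows "path (meridian_curve \<phi> t w)" "path_image (meridian_curve \<phi> t w) \<subseteq> knot_exterior \<phi>"
    "pathstart (meridian_curve \<phi> t w) = \<phi> (t, w)" "pathfinish (meridian_curve \<phi> t w) = \<phi> (t, w)"
proof -
  have w: "w = cis (Arg w)"
    using assms(2) by (metis cis_Arg_unique complex_eq_0 norm_zero zero_neq_one cis_Arg sgn_eq div_by_1 of_real_1)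
  \<comment> \<open>The lift of the meridian curve to the plane is a vertical segment of length
    \<open>2 * pi\<close>.\<close>
  have "meridian_curve \<phi> t w = (\<lambda>x. \<phi> (fst x, cis (snd x))) \<circ> (\<lambda>s. (t, Arg w + 2 * pi * s))"
    by (subst w) (simp add: meridian_curve_def fun_eq_iff cis_mult)
  moreover have "path ((\<lambda>x. \<phi> (fst x, cis (snd x))) \<circ> (\<lambda>s. (t, Arg w + 2 * pi * s)))"
    by (intro path_continuous_image continuous_on_subset[OF continuous_on_tube_boundary[OF assms(1)]])
       (auto simp: path_def intro!: continuous_intros)
  ultimately show "path (meridian_curve \<phi> t w)"
    by simp
  show "path_image (meridian_curve \<phi> t w) \<subseteq> knot_exterior \<phi>"
    using assms
    by (auto simp: path_image_def meridian_curve_def norm_mult intro!: tube_boundary_in_knot_exterior)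
qed (simp_all add: meridian_curve_def pathstart_def pathfinish_def)

lemma meridian_in_carrier:
  assumes "tubular_neighbourhood k \<phi>" "a \<in> meridians \<phi> x0"
  shows "a \<in> carrier (knot_group \<phi> x0)"
  using assms(2) meridian_curve_path[OF assms(1)]
  unfolding meridians_def knot_group_def
  by (auto intro!: fundamental_groupI simp: loops_at_def subset_path_image_join)

text \<open>
  The curves lift to the plane along \<open>(t, \<theta>) \<mapsto> \<phi> (t, e\<^sup>i\<^sup>\<theta>)\<close>, where paths with common endpoints are
  homotopic.
\<close>

lemma meridian_curves_homotopic_along_boundary:
  assumes tub: "tubular_neighbourhood k \<phi>" and w: "norm w = 1" "norm w' = 1"
  obtains \<delta> where "path \<delta>" "path_image \<delta> \<subseteq> knot_exterior \<phi>" "pathstart \<delta> = \<phi> (t, w)"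
    "pathfinish \<delta> = \<phi> (t', w')"
    "homotopic_paths (knot_exterior \<phi>)
       (meridian_curve \<phi> t w +++ \<delta>) (\<delta> +++ meridian_curve \<phi> t' w')"
proof -
  define F where "F = (\<lambda>x. \<phi> (fst x, cis (snd x)))"
  have F: "continuous_on UNIV F"
    unfolding F_def by (rule continuous_on_tube_boundary[OF tub])
  have Fim: "F x \<in> knot_exterior \<phi>" for x
    unfolding F_def by (rule tube_boundary_in_knot_exterior[OF tub]) simp
  obtain a b where ab: "w = cis a" "w' = cis b"
    using w by (metis cis_Arg sgn_eq div_by_1 of_real_1 norm_zero zero_neq_one)
  \<comment> \<open>\<open>m\<close> and \<open>m'\<close> lift the two meridian curves,
    \<open>d\<close> lifts the path sought, and \<open>d'\<close> is \<open>d\<close> translated by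
    the period \<open>2 * pi\<close>, so that it has the same image on the torus.\<close>
  define m where "m = linepath (t, a) (t, a + 2 * pi)"
  define m' where "m' = linepath (t', b) (t', b + 2 * pi)"
  define d where "d = linepath (t, a) (t', b)"
  define d' where "d' = linepath (t, a + 2 * pi) (t', b + 2 * pi)"
  have Fm: "F \<circ> m = meridian_curve \<phi> t w" "F \<circ> m' = meridian_curve \<phi> t' w'"
    by (auto simp: F_def m_def m'_def meridian_curve_def ab cis_mult linepath_def fun_eq_iff
        algebra_simps)
  have shift: "cis (x + 2 * pi) = cis x" for x
    by (simp flip: cis_mult)
  have "(1 - u) * (a + 2 * pi) + u * (b + 2 * pi) = ((1 - u) * a + u * b) + 2 * pi" for u
    by (simp add: algebra_simps)
  then have Fd: "F \<circ> d' = F \<circ> d"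
    by (auto simp: F_def d_def d'_def linepath_def fun_eq_iff shift)
  \<comment> \<open>These are the two ways around a parallelogram in the plane.\<close>
  have "homotopic_paths UNIV (m +++ d') (d +++ m')"
    by (rule homotopic_paths_linear) (auto simp: m_def m'_def d_def d'_def)
  then have "homotopic_paths (knot_exterior \<phi>) (F \<circ> (m +++ d')) (F \<circ> (d +++ m'))"
    by (rule homotopic_paths_continuous_image) (use F Fim in auto)
  then have "homotopic_paths (knot_exterior \<phi>)
      (meridian_curve \<phi> t w +++ (F \<circ> d)) ((F \<circ> d) +++ meridian_curve \<phi> t' w')"
    by (simp add: path_compose_join Fm Fd)
  moreover have "path (F \<circ> d)"
    by (intro path_continuous_image continuous_on_subset[OF F]) (auto simp: d_def)
  moreover have "path_image (F \<circ> d) \<subseteq> knot_exterior \<phi>"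
    by (auto simp: path_image_def intro: Fim)
  moreover have "pathstart (F \<circ> d) = \<phi> (t, w)" "pathfinish (F \<circ> d) = \<phi> (t', w')"
    by (auto simp: pathstart_compose pathfinish_compose d_def F_def ab)
  ultimately show ?thesis
    using that by blast
qed

text \<open>Conjugacy is written without inverses, ready to become an intertwining relation between
  matrices.\<close>

lemma meridians_conjugate:
  assumes tub: "tubular_neighbourhood k \<phi>"
    and a: "a \<in> meridians \<phi> x0" and b: "b \<in> meridians \<phi> x0"
  obtains c where "c \<in> carrier (knot_group \<phi> x0)"
    "a \<otimes>\<^bsub>knot_group \<phi> x0\<^esub> c = c \<otimes>\<^bsub>knot_group \<phi> x0\<^esub> b"
proof -
  let ?X = "knot_exterior \<phi>"
  obtain p t w where p: "norm w = 1" "path p" "path_image p \<subseteq> ?X" "pathstart p = x0"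
      "pathfinish p = \<phi> (t, w)"
    and a_eq: "a = path_class ?X (p +++ meridian_curve \<phi> t w +++ reversepath p)"
    using a unfolding meridians_def by blast
  obtain q t' w' where q: "norm w' = 1" "path q" "path_image q \<subseteq> ?X" "pathstart q = x0"
      "pathfinish q = \<phi> (t', w')"
    and b_eq: "b = path_class ?X (q +++ meridian_curve \<phi> t' w' +++ reversepath q)"
    using b unfolding meridians_def by blast
  let ?m = "meridian_curve \<phi> t w" and ?m' = "meridian_curve \<phi> t' w'"
  note m = meridian_curve_path[OF tub p(1), of t] and m' = meridian_curve_path[OF tub q(1), of t']
  obtain \<delta> where \<delta>: "path \<delta>" "path_image \<delta> \<subseteq> ?X" "pathstart \<delta> = \<phi> (t, w)"
      "pathfinish \<delta> = \<phi> (t', w')"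
    and hom: "homotopic_paths ?X (?m +++ \<delta>) (\<delta> +++ ?m')"
    using meridian_curves_homotopic_along_boundary[OF tub p(1) q(1)] by metis
  \<comment> \<open>The conjugating loop leaves along the tail of \<open>a\<close>, follows the
    torus, and returns along the tail of \<open>b\<close>.\<close>
  define c where "c = p +++ \<delta> +++ reversepath q"
  have loops: "p +++ ?m +++ reversepath p \<in> loops_at ?X x0"
    "q +++ ?m' +++ reversepath q \<in> loops_at ?X x0" "c \<in> loops_at ?X x0"
    using p q m m' \<delta> by (auto simp: loops_at_def c_def subset_path_image_join)
  \<comment> \<open>Here the tail that cancels is \<open>p\<close>; on the other side of the
    identity it is \<open>q\<close>.\<close>
  have "homotopic_paths ?X ((p +++ ?m +++ reversepath p) +++ c)
      (p +++ (?m +++ \<delta>) +++ reversepath q)"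
    unfolding c_def using p q m \<delta> by (intro homotopic_paths_join_tails) auto
  also have "homotopic_paths ?X \<dots> (p +++ (\<delta> +++ ?m') +++ reversepath q)"
    using p q m \<delta> by (intro homotopic_paths_join hom) auto
  also have "homotopic_paths ?X \<dots> (c +++ (q +++ ?m' +++ reversepath q))"
    unfolding c_def using p q m' \<delta>
    by (intro homotopic_paths_sym[OF homotopic_paths_join_tails]) auto
  finally have "a \<otimes>\<^bsub>knot_group \<phi> x0\<^esub> path_class ?X c = path_class ?X c \<otimes>\<^bsub>knot_group \<phi> x0\<^esub> b"
    unfolding a_eq b_eq knot_group_def using loops by (simp add: path_class_mult path_class_eqI)
  moreover have "path_class ?X c \<in> carrier (knot_group \<phi> x0)"
    unfolding knot_group_def using loops(3) by (rule fundamental_groupI)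
  ultimately show ?thesis
    using that by blast
qed

section \<open>Representations generated by elements with a hyperplane of fixed vectors\<close>

lemma group_GL: "group (GL :: ('k::field^'n^'n) monoid)"
proof (rule groupI)
  show "\<exists>y\<in>carrier GL. y \<otimes>\<^bsub>GL\<^esub> x = \<one>\<^bsub>GL\<^esub>" if "x \<in> carrier GL" for x :: "'k^'n^'n"
    using that by (auto simp: GL_def invertible_def)
qed (auto simp: GL_def invertible_mult matrix_mul_assoc invertible_def[of "mat 1"] intro: exI[of _ "mat 1"])

lemma representation_mult:
  assumes "representation G \<rho>" "a \<in> carrier G" "b \<in> carrier G"
  shows "\<rho> (a \<otimes>\<^bsub>G\<^esub> b) = \<rho> a ** \<rho> b"
  using hom_mult[of \<rho> G GL a b] assms by (simp add: representation_def GL_def)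

lemma representation_one:
  assumes "group G" "representation G \<rho>"
  shows "\<rho> \<one>\<^bsub>G\<^esub> = mat 1"
  using hom_one[of \<rho> G GL] assms group_GL by (simp add: representation_def GL_def)

lemma representation_invertible:
  assumes "representation G \<rho>" "a \<in> carrier G"
  shows "invertible (\<rho> a)"
  using hom_in_carrier[of \<rho> G GL a] assms by (simp add: representation_def GL_def)

section \<open>Eigenspaces and fixed vectors\<close>

lemma subspace_eigenspace: "vec.subspace (eigenspace A c)"
  unfolding eigenspace_def
  by (auto simp: vec.subspace_def matrix_vector_right_distrib vector_smult_assoc mult.commute
      vec.scale vector_add_ldistrib)

text \<open>The injective map \<open>C\<close> carries each eigenspace of \<open>B\<close> onto that
  of \<open>A\<close> for the same eigenvalue.\<close>

lemma eigenvalue_multiplicity_intertwined: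
  fixes A B C :: "'k::field^'n^'n"
  assumes "A ** C = C ** B" "invertible C"
  shows "eigenvalue_multiplicity A c = eigenvalue_multiplicity B c"
proof -
  obtain C' where C': "C ** C' = mat 1" "C' ** C = mat 1"
    using assms(2) invertible_def by blast
  have inv: "C *v (C' *v v) = v" "C' *v (C *v v) = v" for v
    using C' by (simp_all add: matrix_vector_mul_assoc)
  have comm: "A *v (C *v v) = C *v (B *v v)" for v
    using assms(1) by (simp add: matrix_vector_mul_assoc)
  have "eigenspace A c = (*v) C ` eigenspace B c"
  proof (intro equalityI subsetI)
    fix v assume v: "v \<in> eigenspace A c"
    then have "C *v (B *v (C' *v v)) = c *s v"
      using comm[of "C' *v v"] by (simp add: inv eigenspace_def)
    then have "B *v (C' *v v) = c *s (C' *v v)"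
      by (metis inv(2) vec.scale)
    then show "v \<in> (*v) C ` eigenspace B c"
      by (intro image_eqI[of _ _ "C' *v v"]) (simp_all add: inv eigenspace_def)
  qed (auto simp: eigenspace_def comm vec.scale)
  moreover have "inj ((*v) C)"
    by (metis inv(2) injI)
  ultimately show ?thesis
    unfolding eigenvalue_multiplicity_def
    by (metis vec.dim_image_eq matrix_vector_mul_linear_gen inj_on_subset subset_UNIV)
qed

text \<open>The fixed vectors form a hyperplane, which \<open>A - 1\<close> kills; so the image of
  \<open>A - 1\<close> is spanned by its value at a single vector \<open>e\<close> outside the
  hyperplane.\<close>

lemma moves_within_line:
  fixes A :: "'k::field^'n^'n"
  assumes "eigenvalue_multiplicity A 1 = CARD('n) - 1"
  obtains u where "\<And>v. A *v v - v \<in> vec.span {u}"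
proof -
  have dim: "vec.dim (eigenspace A 1) = CARD('n) - 1"
    using assms by (simp add: eigenvalue_multiplicity_def)
  \<comment> \<open>Index types are nonempty, so the truncated subtraction is a genuine one.\<close>
  moreover have "CARD('n) - 1 < CARD('n)"
    by simp
  ultimately have "eigenspace A 1 \<noteq> UNIV"
    using vec_dim_card[where 'a='k and 'n='n] by (metis less_irrefl)
  then obtain e where e: "e \<notin> eigenspace A 1"
    by blast
  have span: "vec.span (eigenspace A 1) = eigenspace A 1"
    by (rule vec.span_eq_iff[THEN iffD2, OF subspace_eigenspace])
  have "vec.dim (insert e (eigenspace A 1)) = CARD('n)"
    using e dim \<open>CARD('n) - 1 < CARD('n)\<close> by (simp add: vec.dim_insert span)
  then have "vec.span (insert e (eigenspace A 1)) = UNIV"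
    using vec.dim_eq_full[of "insert e (eigenspace A 1)"] by (simp add: vec.dimension_def card_cart_basis)
  have "A *v v - v \<in> vec.span {A *v e - e}" for v
  proof -
    have "v \<in> vec.span (insert e (eigenspace A 1))"
      using \<open>_ = UNIV\<close> by blast
    then obtain c where "v - c *s e \<in> eigenspace A 1"
      unfolding vec.span_insert span by blast
    then have "A *v v - v = c *s (A *v e - e)"
      by (simp add: eigenspace_def matrix_vector_mult_diff_distrib vec.scale algebra_simps
          vector_ssub_ldistrib)
    then show ?thesis
      by (metis singletonI vec.span_base vec.span_scale)
  qed
  then show ?thesis
    using that by blast
qed

text \<open>The elements acting as the identity modulo \<open>W\<close> are closed under products
  and inverses.\<close>

lemma generate_moves_within:
  fixes \<rho> :: "'g \<Rightarrow> 'k::field^'n^'n"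
  assumes G: "group G" and rep: "representation G \<rho>" and W: "vec.subspace W"
    and S: "S \<subseteq> carrier G" "\<And>a v. a \<in> S \<Longrightarrow> \<rho> a *v v - v \<in> W"
    and x: "x \<in> generate G S"
  shows "\<rho> x *v v - v \<in> W"
  using x
proof (induction arbitrary: v rule: generate.induct)
  case one
  then show ?case
    using representation_one[OF G rep] vec.subspace_0[OF W] by simp
next
  case (incl a)
  then show ?case
    using S(2) by blast
next
  case (inv a)
  have a: "a \<in> carrier G" "inv\<^bsub>G\<^esub> a \<in> carrier G"
    using inv S(1) G by (auto intro: group.inv_closed)
  have "\<rho> a ** \<rho> (inv\<^bsub>G\<^esub> a) = mat 1"
    using a by (metis G group.r_inv rep representation_mult representation_one)
  then have "\<rho> a *v (\<rho> (inv\<^bsub>G\<^esub> a) *v v) = v"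
    by (simp add: matrix_vector_mul_assoc)
  \<comment> \<open>The hypothesis on \<open>a\<close> is applied to the preimage of
    \<open>v\<close> under \<open>\<rho> a\<close>.\<close>
  then have "v - \<rho> (inv\<^bsub>G\<^esub> a) *v v \<in> W"
    using S(2)[OF inv, of "\<rho> (inv\<^bsub>G\<^esub> a) *v v"] by simp
  then show ?case
    using vec.subspace_neg[OF W] by fastforce
next
  case (eng a b)
  have "a \<in> carrier G" "b \<in> carrier G"
    using eng.hyps group.generate_in_carrier[OF G S(1)] by auto
  then have "\<rho> (a \<otimes>\<^bsub>G\<^esub> b) *v v - v = (\<rho> a *v (\<rho> b *v v) - \<rho> b *v v) + (\<rho> b *v v - v)"
    by (simp add: representation_mult[OF rep] matrix_vector_mul_assoc)
  then show ?case
    using vec.subspace_add[OF W eng.IH] by metis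
qed

text \<open>The algebraic core, free of topology. The element \<open>m\<close> serves to exclude
  \<open>W = {0}\<close>.\<close>

lemma irreducible_dimension_le:
  fixes \<rho> :: "'g \<Rightarrow> 'k::field^'n^'n"
  assumes G: "group G" and irr: "irreducible_representation G \<rho>"
    and gen: "g ` I \<subseteq> carrier G" "generate G (g ` I) = carrier G" and "finite I"
    and mult: "\<And>i. i \<in> I \<Longrightarrow> eigenvalue_multiplicity (\<rho> (g i)) 1 = CARD('n) - 1"
    and nontriv: "m \<in> carrier G" "\<rho> m \<noteq> mat 1"
  shows "CARD('n) \<le> card I"
proof -
  have "\<exists>u. \<forall>v. \<rho> (g i) *v v - v \<in> vec.span {u}" if "i \<in> I" for i
    using moves_within_line[OF mult[OF that]] by metis
  then obtain u where u: "\<And>i v. i \<in> I \<Longrightarrow> \<rho> (g i) *v v - v \<in> vec.span {u i}"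
    by metis
  define W where "W = vec.span (u ` I)"
  have W: "vec.subspace W"
    by (simp add: W_def)
  have rep: "representation G \<rho>"
    using irr by (simp add: irreducible_representation_def)
  have span_sub: "vec.span {u i} \<subseteq> W" if "i \<in> I" for i
    unfolding W_def using that by (intro vec.span_mono) blast
  have "\<rho> a *v v - v \<in> W" if "a \<in> g ` I" for a v
    using that u span_sub by blast
  note generate_moves_within[OF G rep W gen(1) this, unfolded gen(2)]
  then have moves: "\<rho> x *v v - v \<in> W" if "x \<in> carrier G" for x v
    using that by blast
  have "\<rho> x *v v \<in> W" if "x \<in> carrier G" "v \<in> W" for x v
    using vec.subspace_add[OF W moves[OF that(1), of v] that(2)] by simp
  then have "W = {0} \<or> W = UNIV"
    using irr W unfolding irreducible_representation_def by blast
  moreover have "W \<noteq> {0}"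
  proof
    assume "W = {0}"
    then have "\<rho> m *v v = mat 1 *v v" for v
      using moves[OF nontriv(1), of v] by simp
    then show False
      using nontriv(2) matrix_eq by blast
  qed
  ultimately have "vec.dim W = CARD('n)"
    using vec_dim_card by metis
  \<comment> \<open>The vectors \<open>u i\<close> may coincide or be dependent, so only an
    inequality results.\<close>
  then have "CARD('n) \<le> card (u ` I)"
    using vec.dim_le_card[of W "u ` I"] \<open>finite I\<close> by (simp add: W_def)
  then show ?thesis
    using card_image_le[OF \<open>finite I\<close>, of u] by linarith
qed

section \<open>The bound for irreducible KCH representations\<close>

theorem theorem1p1:
  fixes k :: "real \<Rightarrow> real^3"
    and \<phi> :: "real \<times> complex \<Rightarrow> real^3"
    and x0 :: "real^3"
    and r :: nat
    and g :: "nat \<Rightarrow> (real \<Rightarrow> real^3) set"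
    and \<rho> :: "(real \<Rightarrow> real^3) set \<Rightarrow> complex^'n^'n"
  assumes "oriented_knot k"
    and "tubular_neighbourhood k \<phi>"
    and "x0 \<in> knot_exterior \<phi>"
    and "meridional_generating_family \<phi> x0 r g"
    and "KCH_representation \<phi> x0 \<rho>"
    and "irreducible_representation (knot_group \<phi> x0) \<rho>"
  shows "CARD('n) \<le> r"
proof -
  let ?G = "knot_group \<phi> x0"
  have G: "group ?G"
    unfolding knot_group_def by (rule group_fundamental_group[OF assms(3)])
  obtain m where rep: "representation ?G \<rho>" and m: "m \<in> meridians \<phi> x0"
    and mult: "eigenvalue_multiplicity (\<rho> m) 1 = CARD('n) - 1"
    using assms(5) unfolding KCH_representation_def by blast
  note carrier = meridian_in_carrier[OF assms(2)]
  have mer: "g i \<in> meridians \<phi> x0" if "i \<in> {1..r}" for i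
    using assms(4) that unfolding meridional_generating_family_def by blast
  have "eigenvalue_multiplicity (\<rho> (g i)) 1 = CARD('n) - 1" if i: "i \<in> {1..r}" for i
  proof -
    obtain c where c: "c \<in> carrier ?G" "g i \<otimes>\<^bsub>?G\<^esub> c = c \<otimes>\<^bsub>?G\<^esub> m"
      using meridians_conjugate[OF assms(2) mer[OF i] m] by metis
    then have "\<rho> (g i) ** \<rho> c = \<rho> c ** \<rho> m"
      using carrier[OF mer[OF i]] carrier[OF m] by (metis rep representation_mult)
    then show ?thesis
      using eigenvalue_multiplicity_intertwined representation_invertible[OF rep c(1)] mult by metis
  qed
  \<comment> \<open>The identity fixes a space of dimension \<open>CARD('n)\<close>, which exceeds
    the prescribed \<open>CARD('n) - 1\<close> because \<open>CARD('n)\<close> is positive.\<close>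
  moreover have "\<rho> m \<noteq> mat 1"
  proof
    assume "\<rho> m = mat 1"
    then have "eigenvalue_multiplicity (\<rho> m) 1 = CARD('n)"
      by (simp add: eigenvalue_multiplicity_def eigenspace_def card_cart_basis)
    then show False
      using mult zero_less_card_finite[where 'a='n] by simp
  qed
  moreover have "generate ?G (g ` {1..r}) = carrier ?G"
    using assms(4) unfolding meridional_generating_family_def by blast
  ultimately have "CARD('n) \<le> card {1..r}"
    using mer carrier m by (intro irreducible_dimension_le[OF G assms(6)]) auto
  then show ?thesis
    by simp
qed

end
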